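(* Let $(\vec X^{m+1},\mu^{m+1},\mu_{\mathcal S}^{m+1},\kappa^{m+1})$, $0\le m\le M-1$, be a numerical solution of the fully discrete scheme (D1)–(D3) (with $\kappa^{m+1}$ determined as in the context), starting from initial data $(\vec X^0,\mu^0,\mu_{\mathcal S}^0,\kappa^0)$. Then $$\mathrm{vol}(\vec X^{m+1})-\mathrm{vol}(\vec X^m)=0,\qquad m=0,1,\dots,M-1,$$ where $\mathrm{vol}(\vec X^m)=2\pi\int_0^1 r^m z^m r^m_\rho\,d\rho$.
   Context: Notation. $\mathbb I=[0,1]$ is divided uniformly into $J$ intervals $\mathbb I_j$ of length $1/J$; $0=t_0<\dots<t_M=T$ and $\Delta t_m=t_{m+1}-t_m$, written $\Delta t$ in step $m\to m+1$. $(u,v)=\int_{\mathbb I}u\cdot v\,d\rho$ for scalar or $\mathbb R^2$-valued functions; the subscript $\rho$ denotes the derivative; $\vec e_1=(1,0)$; $(a,b)^\perp=(b,-a)$. $V^h$ is the space of continuous functions on $\mathbb I$ that are affine on each $\mathbb I_j$; $V^h_0=\{u\in V^h:u(0)=u(1)=0\}$. Data. $\varepsilon>0$, $\eta\in(0,\infty)$, $\sigma\in\mathbb R$; $\gamma:\mathbb R\to(0,\infty)$ is $C^2$, even and $2\pi$-periodic; $\mathscr S$ is a real-valued stability function; $q\in\{0,1\}$ and $$\boldsymbol B_q(\theta)=\begin{pmatrix}\gamma(\theta)&-\gamma'(\theta)\\ \gamma'(\theta)&\gamma(\theta)\end{pmatrix}\begin{pmatrix}\cos2\theta&\sin2\theta\\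 \sin2\theta&-\cos2\theta\end{pmatrix}^{1-q}+\mathscr S(\theta)\left[\tfrac12\boldsymbol I-\tfrac12\begin{pmatrix}\cos2\theta&\sin2\theta\\ \sin2\theta&-\cos2\theta\end{pmatrix}\right],$$ where $\boldsymbol I$ is the $2\times2$ identity matrix. Discrete curves. $\vec X^m=(r^m,z^m)\in V^h\times V^h$ with $r^m\ge0$, $z^m(1)=0$ and $\vec X^m_\rho\ne0$ on each $\mathbb I_j$; $r_i^m=r^m(0)$, $r_o^m=r^m(1)$. Either the film has a hole ($r_i^m>0$ and $z^m(0)=0$ for all $m$), or it is hole-free ($r_i^m=0$ for all $m$, with $z^m(0)$ free). On each $\mathbb I_j$, $\theta^m$ is defined by $\vec X^m_\rho/|\vec X^m_\rho|=(\cos\theta^m,\sin\theta^m)$ and $\vec n^m=-(\vec X^m_\rho)^\perp/|\vec X^m_\rho|$. Let $V^{h,(z)}=V^h_0$ in the case with a hole and $V^{h,(z)}=\{u\in V^h:u(1)=0\}$ in the hole-free case. Put $$\vec f^{\,m+\frac12}=-\tfrac16\left[2r^m\vec X^m_\rho+2r^{m+1}\vec X^{m+1}_\rho+r^m\vec X^{m+1}_\rho+r^{m+1}\vec X^m_\rho\right]^\perp.$$ Scheme. Given $\vec X^m$, $\mu_{\mathcal S}^m\in V_0^h$, $\kappa^m\in V^h$, find $\vec X^{m+1}=(r^{m+1},z^{m+1})\in V^h\times V^h$ with $r^{m+1}\ge0$, $z^{m+1}(1)=0$, $\vec X^{m+1}_\rho\ne0$ on each $\mathbb I_j$, and with $r^{m+1}(0)>0$,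 $z^{m+1}(0)=0$ in the case with a hole, respectively $r^{m+1}(0)=0$ (and $z^{m+1}(0)$ free) in the hole-free case, $\mu^{m+1}\in V^h$, $\mu_{\mathcal S}^{m+1}\in V^h_0$ such that (D1) for all $\phi^h\in V^h$: $\big(\tfrac{\vec X^{m+1}-\vec X^m}{\Delta t},\phi^h\vec f^{\,m+\frac12}\big)+\big(r^m\mu^{m+1}_\rho,\phi^h_\rho|\vec X^m_\rho|^{-1}\big)=0$; (D2) for all $\vec\omega^h=(\omega^h_1,\omega^h_2)\in V^h\times V^{h,(z)}$: $$\begin{aligned}&(\mu^{m+1}\vec f^{\,m+\frac12},\vec\omega^h)-(r^m\boldsymbol B_q(\theta^m)\vec X^{m+1}_\rho,\vec\omega^h_\rho|\vec X^m_\rho|^{-1})\\&+\varepsilon^2\big(r^m(\mu_{\mathcal S}^{m+1})_\rho\vec n^m+\tfrac12r^{m+1}(\mu_{\mathcal S}^{m+1})^2\vec X^{m+1}_\rho+(\vec n^m\cdot\vec e_1)\mu_{\mathcal S}^{m+1}\vec X^m_\rho,\ \vec\omega^h_\rho|\vec X^m_\rho|^{-1}\big)\\&-(\gamma(\theta^{m+1})\vec e_1,\vec\omega^h|\vec X^{m+1}_\rho|)+\tfrac{\varepsilon^2}2((\mu_{\mathcal S}^{m+1})^2\vec e_1,\vec\omega^h|\vec X^m_\rho|)-\varepsilon^2(\mu_{\mathcal S}^{m+1}\kappa^m\vec e_1,\vec\omega^h|\vec X^m_\rho|)\\&-\tfrac1{2\eta\Delta t}\big[(r_i^{m+1}+r_i^m)(r_i^{m+1}-r_i^m)\omega_1^h(0)+(r_o^{m+1}+r_o^m)(r_o^{m+1}-r_o^m)\omega_1^h(1)\big]\\&+\tfrac\sigma2\big[(r_o^{m+1}+r_o^m)\omega_1^h(1)-(r_i^{m+1}+r_i^m)\omega_1^h(0)\big]=0;\end{aligned}$$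 (D3) for all $\psi^h\in V^h_0$: $$\begin{aligned}&\big(\tfrac{r^{m+1}-r^m}{\Delta t}\mu_{\mathcal S}^{m+1},\psi^h|\vec X^m_\rho|\big)+\big(r^m\tfrac{\mu_{\mathcal S}^{m+1}-\mu_{\mathcal S}^m}{\Delta t},\psi^h|\vec X^m_\rho|\big)+\big(r^m\,\vec n^m\cdot\tfrac{\vec X^{m+1}_\rho-\vec X^m_\rho}{\Delta t},\psi^h_\rho|\vec X^m_\rho|^{-1}\big)\\&+\big(r^{m+1}(\vec X^{m+1}_\rho\cdot\tfrac{\vec X^{m+1}_\rho-\vec X^m_\rho}{\Delta t})\mu_{\mathcal S}^{m+1},\psi^h|\vec X^m_\rho|^{-1}\big)+\big((\vec n^m\cdot\vec e_1)(\vec X^m_\rho\cdot\tfrac{\vec X^{m+1}_\rho-\vec X^m_\rho}{\Delta t}),\psi^h|\vec X^m_\rho|^{-1}\big)\\&-\big(\tfrac{r^{m+1}-r^m}{\Delta t}\kappa^m,\psi^h|\vec X^m_\rho|\big)=0.\end{aligned}$$ Then $\kappa^{m+1}\in V^h$ is determined by either $(r^{m+1}\mu_{\mathcal S}^{m+1},\chi^h|\vec X^{m+1}_\rho|)-(r^{m+1}\kappa^{m+1},\chi^h|\vec X^{m+1}_\rho|)+(\vec n^{m+1}\cdot\vec e_1,\chi^h|\vec X^{m+1}_\rho|)=0$ for all $\chi^h\in V^h$, or alternatively $(\kappa^{m+1}\vec n^{m+1},\vec g^h|\vec X_\rho^{m+1}|)-(\vec X^{m+1}_\rho,\vec g^h_\rho|\vec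 X^{m+1}_\rho|^{-1})=0$ for all $\vec g^h\in V^h_0\times V^h_0$. *)

theory Defs
  imports "HOL-Analysis.Analysis"
begin

text \<open>
  A curve is a function \<open>X :: real \<Rightarrow> real ^ 2\<close> of which only the values on \<open>{0..1}\<close> matter, with
  components \<open>r = X $ 1\<close> and \<open>z = X $ 2\<close>. Names without a prime refer to time level \<open>m\<close>, primed
  names to time level \<open>m + 1\<close>.
\<close>

subsection \<open>Finite element spaces\<close>

definition Vh :: "nat \<Rightarrow> (real \<Rightarrow> real) set" where
  "Vh J = {u. continuous_on {0..1} u \<and>
     (\<forall>j<J. \<exists>a b. \<forall>\<rho> \<in> {real j / real J .. real (Suc j) / real J}. u \<rho> = a + b * \<rho>)}"

definition Vh0 :: "nat \<Rightarrow> (real \<Rightarrow> real) set" where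
  "Vh0 J = {u \<in> Vh J. u 0 = 0 \<and> u 1 = 0}"

definition Vhz :: "bool \<Rightarrow> nat \<Rightarrow> (real \<Rightarrow> real) set" where
  "Vhz hole J = (if hole then Vh0 J else {u \<in> Vh J. u 1 = 0})"

definition prod_space :: "(real \<Rightarrow> real) set \<Rightarrow> (real \<Rightarrow> real) set \<Rightarrow> (real \<Rightarrow> real ^ 2) set" where
  "prod_space U V = {w. (\<lambda>\<rho>. w \<rho> $ 1) \<in> U \<and> (\<lambda>\<rho>. w \<rho> $ 2) \<in> V}"

subsection \<open>Derivatives, inner products and geometry of discrete curves\<close>

text \<open>
  For elements of the finite element spaces \<open>drho\<close> is the elementwise derivative on the interiors
  of the mesh intervals. Its unspecified values at the finitely many mesh points do not affect any
  of the integrals below.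
\<close>

definition drho :: "(real \<Rightarrow> 'a::real_normed_vector) \<Rightarrow> real \<Rightarrow> 'a" where
  "drho u \<rho> = vector_derivative u (at \<rho> within {0..1})"

definition ip :: "(real \<Rightarrow> 'a::real_inner) \<Rightarrow> (real \<Rightarrow> 'a) \<Rightarrow> real" where
  "ip u v = integral {0..1} (\<lambda>\<rho>. u \<rho> \<bullet> v \<rho>)"

definition e1 :: "real ^ 2" where
  "e1 = vector [1, 0]"

definition perp :: "real ^ 2 \<Rightarrow> real ^ 2" where
  "perp v = vector [v $ 2, - (v $ 1)]"

definition nvec :: "(real \<Rightarrow> real ^ 2) \<Rightarrow> real \<Rightarrow> real ^ 2" where
  "nvec X \<rho> = - (perp (drho X \<rho>) /\<^sub>R norm (drho X \<rho>))"

definition vol :: "(real \<Rightarrow> real ^ 2) \<Rightarrow> real" where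
  "vol X = 2 * pi * integral {0..1} (\<lambda>\<rho>. X \<rho> $ 1 * X \<rho> $ 2 * drho (\<lambda>s. X s $ 1) \<rho>)"

definition discrete_curve :: "bool \<Rightarrow> nat \<Rightarrow> (real \<Rightarrow> real ^ 2) \<Rightarrow> bool" where
  "discrete_curve hole J X \<longleftrightarrow>
     X \<in> prod_space (Vh J) (Vh J) \<and>
     (\<forall>\<rho> \<in> {0..1}. X \<rho> $ 1 \<ge> 0) \<and>
     X 1 $ 2 = 0 \<and>
     (\<forall>j<J. \<forall>\<rho> \<in> {real j / real J <..< real (Suc j) / real J}. drho X \<rho> \<noteq> 0) \<and>
     (if hole then X 0 $ 1 > 0 \<and> X 0 $ 2 = 0 else X 0 $ 1 = 0)"

text \<open>
  The angle is constant on each mesh interval; its representative modulo \<open>2 * pi\<close> is not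
  prescribed.
\<close>

definition tangent_angle :: "nat \<Rightarrow> (real \<Rightarrow> real ^ 2) \<Rightarrow> (real \<Rightarrow> real) \<Rightarrow> bool" where
  "tangent_angle J X \<theta> \<longleftrightarrow>
     (\<forall>j<J. \<exists>a. \<forall>\<rho> \<in> {real j / real J <..< real (Suc j) / real J}.
        \<theta> \<rho> = a \<and> drho X \<rho> /\<^sub>R norm (drho X \<rho>) = vector [cos a, sin a])"

subsection \<open>Surface energy data\<close>

definition C2 :: "(real \<Rightarrow> real) \<Rightarrow> bool" where
  "C2 g \<longleftrightarrow> g differentiable_on UNIV \<and> deriv g C1_differentiable_on UNIV"

definition Rmat :: "real \<Rightarrow> real ^ 2 ^ 2" where
  "Rmat \<theta> = vector [vector [cos (2 * \<theta>), sin (2 * \<theta>)],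
                    vector [sin (2 * \<theta>), - cos (2 * \<theta>)]]"

text \<open>
  The power \<open>1 - q\<close> is taken with respect to matrix multiplication (\<open>*\<close> and \<open>^\<close> on
  \<open>real ^ 2 ^ 2\<close> would be componentwise).
\<close>

definition Bmat :: "nat \<Rightarrow> (real \<Rightarrow> real) \<Rightarrow> (real \<Rightarrow> real) \<Rightarrow> real \<Rightarrow> real ^ 2 ^ 2" where
  "Bmat q \<gamma> S \<theta> =
     vector [vector [\<gamma> \<theta>, - deriv \<gamma> \<theta>], vector [deriv \<gamma> \<theta>, \<gamma> \<theta>]]
       ** (((**) (Rmat \<theta>)) ^^ (1 - q)) (mat 1)
     + S \<theta> *\<^sub>R ((1 / 2) *\<^sub>R mat 1 - (1 / 2) *\<^sub>R Rmat \<theta>)"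

subsection \<open>The fully discrete scheme\<close>

definition fhalf :: "(real \<Rightarrow> real ^ 2) \<Rightarrow> (real \<Rightarrow> real ^ 2) \<Rightarrow> real \<Rightarrow> real ^ 2" where
  "fhalf X X' \<rho> = - (1 / 6) *\<^sub>R perp
     ((2 * X \<rho> $ 1) *\<^sub>R drho X \<rho> + (2 * X' \<rho> $ 1) *\<^sub>R drho X' \<rho>
      + X \<rho> $ 1 *\<^sub>R drho X' \<rho> + X' \<rho> $ 1 *\<^sub>R drho X \<rho>)"

definition eqD1 :: "nat \<Rightarrow> real \<Rightarrow> (real \<Rightarrow> real ^ 2) \<Rightarrow> (real \<Rightarrow> real ^ 2) \<Rightarrow> (real \<Rightarrow> real) \<Rightarrow> bool" where
  "eqD1 J dt X X' \<mu>' \<longleftrightarrow>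
     (\<forall>\<phi> \<in> Vh J.
        ip (\<lambda>\<rho>. (X' \<rho> - X \<rho>) /\<^sub>R dt) (\<lambda>\<rho>. \<phi> \<rho> *\<^sub>R fhalf X X' \<rho>)
        + ip (\<lambda>\<rho>. X \<rho> $ 1 * drho \<mu>' \<rho>) (\<lambda>\<rho>. drho \<phi> \<rho> / norm (drho X \<rho>)) = 0)"

definition eqD2 :: "bool \<Rightarrow> nat \<Rightarrow> nat \<Rightarrow> real \<Rightarrow> real \<Rightarrow> real \<Rightarrow> (real \<Rightarrow> real) \<Rightarrow> (real \<Rightarrow> real) \<Rightarrow> real
    \<Rightarrow> (real \<Rightarrow> real ^ 2) \<Rightarrow> (real \<Rightarrow> real) \<Rightarrow> (real \<Rightarrow> real)
    \<Rightarrow> (real \<Rightarrow> real ^ 2) \<Rightarrow> (real \<Rightarrow> real) \<Rightarrow> (real \<Rightarrow> real) \<Rightarrow> (real \<Rightarrow> real) \<Rightarrow> bool" where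
  "eqD2 hole J q \<epsilon> \<eta> \<sigma> \<gamma> S dt X \<theta> \<kappa> X' \<theta>' \<mu>' \<mu>S' \<longleftrightarrow>
     (\<forall>\<omega> \<in> prod_space (Vh J) (Vhz hole J).
        ip (\<lambda>\<rho>. \<mu>' \<rho> *\<^sub>R fhalf X X' \<rho>) \<omega>
        - ip (\<lambda>\<rho>. X \<rho> $ 1 *\<^sub>R (Bmat q \<gamma> S (\<theta> \<rho>) *v drho X' \<rho>))
             (\<lambda>\<rho>. drho \<omega> \<rho> /\<^sub>R norm (drho X \<rho>))
        + \<epsilon>\<^sup>2 * ip (\<lambda>\<rho>. (X \<rho> $ 1 * drho \<mu>S' \<rho>) *\<^sub>R nvec X \<rho>
                      + (1 / 2 * X' \<rho> $ 1 * (\<mu>S' \<rho>)\<^sup>2) *\<^sub>R drho X' \<rho>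
                      + ((nvec X \<rho> \<bullet> e1) * \<mu>S' \<rho>) *\<^sub>R drho X \<rho>)
                   (\<lambda>\<rho>. drho \<omega> \<rho> /\<^sub>R norm (drho X \<rho>))
        - ip (\<lambda>\<rho>. \<gamma> (\<theta>' \<rho>) *\<^sub>R e1) (\<lambda>\<rho>. norm (drho X' \<rho>) *\<^sub>R \<omega> \<rho>)
        + \<epsilon>\<^sup>2 / 2 * ip (\<lambda>\<rho>. (\<mu>S' \<rho>)\<^sup>2 *\<^sub>R e1) (\<lambda>\<rho>. norm (drho X \<rho>) *\<^sub>R \<omega> \<rho>)
        - \<epsilon>\<^sup>2 * ip (\<lambda>\<rho>. (\<mu>S' \<rho> * \<kappa> \<rho>) *\<^sub>R e1) (\<lambda>\<rho>. norm (drho X \<rho>) *\<^sub>R \<omega> \<rho>)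
        - 1 / (2 * \<eta> * dt) *
            ((X' 0 $ 1 + X 0 $ 1) * (X' 0 $ 1 - X 0 $ 1) * \<omega> 0 $ 1
             + (X' 1 $ 1 + X 1 $ 1) * (X' 1 $ 1 - X 1 $ 1) * \<omega> 1 $ 1)
        + \<sigma> / 2 * ((X' 1 $ 1 + X 1 $ 1) * \<omega> 1 $ 1 - (X' 0 $ 1 + X 0 $ 1) * \<omega> 0 $ 1)
        = 0)"

definition eqD3 :: "nat \<Rightarrow> real \<Rightarrow> (real \<Rightarrow> real ^ 2) \<Rightarrow> (real \<Rightarrow> real) \<Rightarrow> (real \<Rightarrow> real)
    \<Rightarrow> (real \<Rightarrow> real ^ 2) \<Rightarrow> (real \<Rightarrow> real) \<Rightarrow> bool" where
  "eqD3 J dt X \<mu>S \<kappa> X' \<mu>S' \<longleftrightarrow>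
     (\<forall>\<psi> \<in> Vh0 J.
        ip (\<lambda>\<rho>. (X' \<rho> $ 1 - X \<rho> $ 1) / dt * \<mu>S' \<rho>) (\<lambda>\<rho>. \<psi> \<rho> * norm (drho X \<rho>))
        + ip (\<lambda>\<rho>. X \<rho> $ 1 * ((\<mu>S' \<rho> - \<mu>S \<rho>) / dt)) (\<lambda>\<rho>. \<psi> \<rho> * norm (drho X \<rho>))
        + ip (\<lambda>\<rho>. X \<rho> $ 1 * (nvec X \<rho> \<bullet> ((drho X' \<rho> - drho X \<rho>) /\<^sub>R dt)))
             (\<lambda>\<rho>. drho \<psi> \<rho> / norm (drho X \<rho>))
        + ip (\<lambda>\<rho>. X' \<rho> $ 1 * (drho X' \<rho> \<bullet> ((drho X' \<rho> - drho X \<rho>) /\<^sub>R dt)) * \<mu>S' \<rho>)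
             (\<lambda>\<rho>. \<psi> \<rho> / norm (drho X \<rho>))
        + ip (\<lambda>\<rho>. (nvec X \<rho> \<bullet> e1) * (drho X \<rho> \<bullet> ((drho X' \<rho> - drho X \<rho>) /\<^sub>R dt)))
             (\<lambda>\<rho>. \<psi> \<rho> / norm (drho X \<rho>))
        - ip (\<lambda>\<rho>. (X' \<rho> $ 1 - X \<rho> $ 1) / dt * \<kappa> \<rho>) (\<lambda>\<rho>. \<psi> \<rho> * norm (drho X \<rho>))
        = 0)"

text \<open>The two alternative equations for the curvature update; all arguments are at level \<open>m + 1\<close>.\<close>

definition kappa_eq_a :: "nat \<Rightarrow> (real \<Rightarrow> real ^ 2) \<Rightarrow> (real \<Rightarrow> real) \<Rightarrow> (real \<Rightarrow> real) \<Rightarrow> bool" where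
  "kappa_eq_a J X' \<mu>S' \<kappa>' \<longleftrightarrow>
     (\<forall>\<xi> \<in> Vh J.
        ip (\<lambda>\<rho>. X' \<rho> $ 1 * \<mu>S' \<rho>) (\<lambda>\<rho>. \<xi> \<rho> * norm (drho X' \<rho>))
        - ip (\<lambda>\<rho>. X' \<rho> $ 1 * \<kappa>' \<rho>) (\<lambda>\<rho>. \<xi> \<rho> * norm (drho X' \<rho>))
        + ip (\<lambda>\<rho>. nvec X' \<rho> \<bullet> e1) (\<lambda>\<rho>. \<xi> \<rho> * norm (drho X' \<rho>)) = 0)"

definition kappa_eq_b :: "nat \<Rightarrow> (real \<Rightarrow> real ^ 2) \<Rightarrow> (real \<Rightarrow> real) \<Rightarrow> bool" where
  "kappa_eq_b J X' \<kappa>' \<longleftrightarrow>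
     (\<forall>g \<in> prod_space (Vh0 J) (Vh0 J).
        ip (\<lambda>\<rho>. \<kappa>' \<rho> *\<^sub>R nvec X' \<rho>) (\<lambda>\<rho>. norm (drho X' \<rho>) *\<^sub>R g \<rho>)
        - ip (drho X') (\<lambda>\<rho>. drho g \<rho> /\<^sub>R norm (drho X' \<rho>)) = 0)"

definition scheme_step :: "bool \<Rightarrow> nat \<Rightarrow> nat \<Rightarrow> real \<Rightarrow> real \<Rightarrow> real \<Rightarrow> (real \<Rightarrow> real) \<Rightarrow> (real \<Rightarrow> real) \<Rightarrow> real
    \<Rightarrow> (real \<Rightarrow> real ^ 2) \<Rightarrow> (real \<Rightarrow> real) \<Rightarrow> (real \<Rightarrow> real) \<Rightarrow> (real \<Rightarrow> real)
    \<Rightarrow> (real \<Rightarrow> real ^ 2) \<Rightarrow> (real \<Rightarrow> real) \<Rightarrow> (real \<Rightarrow> real) \<Rightarrow> (real \<Rightarrow> real) \<Rightarrow> (real \<Rightarrow> real) \<Rightarrow> bool" where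
  "scheme_step hole J q \<epsilon> \<eta> \<sigma> \<gamma> S dt X \<theta> \<mu>S \<kappa> X' \<theta>' \<mu>' \<mu>S' \<kappa>' \<longleftrightarrow>
     discrete_curve hole J X' \<and> tangent_angle J X' \<theta>' \<and>
     \<mu>' \<in> Vh J \<and> \<mu>S' \<in> Vh0 J \<and> \<kappa>' \<in> Vh J \<and>
     eqD1 J dt X X' \<mu>' \<and>
     eqD2 hole J q \<epsilon> \<eta> \<sigma> \<gamma> S dt X \<theta> \<kappa> X' \<theta>' \<mu>' \<mu>S' \<and>
     eqD3 J dt X \<mu>S \<kappa> X' \<mu>S' \<and>
     (kappa_eq_a J X' \<mu>S' \<kappa>' \<or> kappa_eq_b J X' \<kappa>')"

end

theory Submission
  imports Defs
begin

text \<open>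
  Test (D1) with the constant \<open>\<phi> = 1\<close>, so that the diffusion term vanishes. Multiplied by
  \<open>6 \<Delta>t\<close>, the remaining integrand is \<open>6 (r' z' r'\<^sub>\<rho> - r z r\<^sub>\<rho>)\<close> plus the \<open>\<rho>\<close>-derivative of
  \<open>(z' - z) (r\<^sup>2 + r r' + r'\<^sup>2) - 3 r'\<^sup>2 z' + 3 r\<^sup>2 z\<close>. This primitive vanishes at both end points, at \<open>\<rho> = 1\<close>
  because \<open>z = z' = 0\<close> and at \<open>\<rho> = 0\<close> because \<open>z = z' = 0\<close> or \<open>r = r' = 0\<close>.
\<close>

section \<open>Mesh cells and elementwise derivatives\<close>

definition mesh :: "nat \<Rightarrow> real set" where
  "mesh J = (\<lambda>j. real j / real J) ` {..J}"

lemma finite_mesh: "finite (mesh J)"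
  by (simp add: mesh_def)

text \<open>The cell index is the floor of \<open>\<rho> * real J\<close>. The floor only places the
  point in a half-open cell; excluding mesh points makes the lower bound strict.\<close>

lemma mesh_cell:
  assumes "\<rho> \<in> {0<..<1} - mesh J" and "J \<ge> 1"
  obtains j where "j < J" "\<rho> \<in> {real j / real J <..< real (Suc j) / real J}"
proof -
  define j where "j = nat \<lfloor>\<rho> * real J\<rfloor>"
  have J: "real J > 0" using assms(2) by simp
  have \<rho>: "0 < \<rho>" "\<rho> < 1" using assms(1) by auto
  have "0 \<le> \<rho> * real J" using \<rho> J by simp
  then have "real j = of_int \<lfloor>\<rho> * real J\<rfloor>" by (simp add: j_def)
  then have le: "real j \<le> \<rho> * real J" and less: "\<rho> * real J < real (Suc j)"
    using floor_correct[of "\<rho> * real J"] by linarith+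
  have "\<rho> * real J < real J" using \<rho> J by simp
  with le have jJ: "j < J" by linarith
  then have "real j / real J \<in> mesh J" by (auto simp: mesh_def)
  with assms(1) have "\<rho> \<noteq> real j / real J" by auto
  moreover have "real j / real J \<le> \<rho>" "\<rho> < real (Suc j) / real J"
    using le less J by (simp_all add: pos_divide_le_eq pos_less_divide_eq)
  ultimately have "\<rho> \<in> {real j / real J <..< real (Suc j) / real J}" by simp
  with jJ show thesis by (rule that)
qed

text \<open>Derivatives within a nondegenerate closed interval are unique even at its end points, so
  the choice inside \<open>vector_derivative\<close> must return \<open>b\<close>.\<close>

lemma drho_eqI:
  assumes "(u has_vector_derivative b) (at \<rho> within {0..1})" and "\<rho> \<in> {0..1}"
  shows "drho u \<rho> = b"
  unfolding drho_def
  by (rule vector_derivative_within_cbox[of 0 1, unfolded box_real]) (use assms in simp_all)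

lemma drho_const [simp]: "\<rho> \<in> {0..1} \<Longrightarrow> drho (\<lambda>_. c) \<rho> = 0"
  by (intro drho_eqI) auto

lemma cell_subset:
  assumes "j < J"
  shows "{real j / real J <..< real (Suc j) / real J} \<subseteq> {0<..<1}"
proof
  fix x assume x: "x \<in> {real j / real J <..< real (Suc j) / real J}"
  have "real (Suc j) / real J \<le> 1" "0 \<le> real j / real J"
    using assms by (auto simp: divide_le_eq_1)
  with x show "x \<in> {0<..<1}" by (meson greaterThanLessThan_iff le_less_trans less_le_trans)
qed

lemma Vh_const: "(\<lambda>_. c) \<in> Vh J"
  proof -
  have "\<exists>a b. \<forall>\<rho>\<in>I. c = a + b * \<rho>" for I
    by (rule exI[of _ c], rule exI[of _ 0]) simp
  then show ?thesis by (simp add: Vh_def)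
qed

lemma Vh_continuous: "u \<in> Vh J \<Longrightarrow> continuous_on {0..1} u"
  by (simp add: Vh_def)

text \<open>One slope \<open>b\<close> serves the whole cell, which integrability of
  \<open>drho u\<close> relies on later. Openness of the cell turns the local affine formula into a
  two-sided derivative.\<close>

lemma Vh_cell_derivative:
  assumes "u \<in> Vh J" and "j < J"
  obtains b where
    "\<And>\<rho>. \<rho> \<in> {real j / real J <..< real (Suc j) / real J} \<Longrightarrow> (u has_vector_derivative b) (at \<rho>)"
proof -
  let ?I = "{real j / real J <..< real (Suc j) / real J}"
  obtain a b where ab: "\<And>\<rho>. \<rho> \<in> {real j / real J .. real (Suc j) / real J} \<Longrightarrow> u \<rho> = a + b * \<rho>"
    using assms unfolding Vh_def by blast
  show thesis
  proof (rule that[of b])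
    fix \<rho> assume \<rho>: "\<rho> \<in> ?I"
    have "((\<lambda>x. a + b * x) has_vector_derivative b) (at \<rho>)"
      by (auto intro!: derivative_eq_intros)
    then show "(u has_vector_derivative b) (at \<rho>)"
      by (rule has_vector_derivative_transform_within_open[where S = ?I]) (use \<rho> ab in auto)
  qed
qed

lemma Vh_has_vector_derivative:
  assumes "u \<in> Vh J" and "\<rho> \<in> {0<..<1} - mesh J" and "J \<ge> 1"
  shows "(u has_vector_derivative drho u \<rho>) (at \<rho>)"
proof -
  obtain j where j: "j < J" "\<rho> \<in> {real j / real J <..< real (Suc j) / real J}"
    using assms(2,3) by (rule mesh_cell)
  obtain b where "(u has_vector_derivative b) (at \<rho>)"
    using assms(1) j by (meson Vh_cell_derivative)
  moreover from this assms(2) have "drho u \<rho> = b"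
    by (intro drho_eqI[OF has_vector_derivative_at_within]) auto
  ultimately show ?thesis by simp
qed

text \<open>\<open>drho X\<close> is chosen without reference to components. Expanding
  \<open>X\<close> in the standard basis produces a vector derivative from the component ones, and
  uniqueness identifies the two.\<close>

lemma drho_component:
  fixes X :: "real \<Rightarrow> real ^ 2"
  assumes "X \<in> prod_space (Vh J) (Vh J)" and "\<rho> \<in> {0<..<1} - mesh J" and "J \<ge> 1"
  shows "drho X \<rho> $ 1 = drho (\<lambda>s. X s $ 1) \<rho>" and "drho X \<rho> $ 2 = drho (\<lambda>s. X s $ 2) \<rho>"
proof -
  have *: "((\<lambda>s. X s $ 1) has_vector_derivative drho (\<lambda>s. X s $ 1) \<rho>) (at \<rho>)"
    "((\<lambda>s. X s $ 2) has_vector_derivative drho (\<lambda>s. X s $ 2) \<rho>) (at \<rho>)"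
    using assms by (auto simp: prod_space_def intro!: Vh_has_vector_derivative)
  have X: "X = (\<lambda>s. X s $ 1 *\<^sub>R axis 1 1 + X s $ 2 *\<^sub>R axis 2 1)"
    by (auto simp: fun_eq_iff vec_eq_iff forall_2 axis_def)
  let ?d = "drho (\<lambda>s. X s $ 1) \<rho> *\<^sub>R axis 1 1 + drho (\<lambda>s. X s $ 2) \<rho> *\<^sub>R axis 2 1 :: real ^ 2"
  have "((\<lambda>s. X s $ 1 *\<^sub>R axis 1 1 + X s $ 2 *\<^sub>R axis 2 1) has_vector_derivative ?d) (at \<rho>)"
    by (intro has_vector_derivative_add bounded_linear.has_vector_derivative
        [OF bounded_linear_scaleR_left] *)
  then have "(X has_vector_derivative ?d) (at \<rho>)" by (subst X)
  with assms(2) have "drho X \<rho> = ?d" by (intro drho_eqI[OF has_vector_derivative_at_within]) auto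
  then show "drho X \<rho> $ 1 = drho (\<lambda>s. X s $ 1) \<rho>" "drho X \<rho> $ 2 = drho (\<lambda>s. X s $ 2) \<rho>"
    by (simp_all add: axis_def)
qed

text \<open>\<open>drho u\<close> may jump at mesh points, so continuity is available only cell by
  cell; the induction on \<open>k\<close> glues the first \<open>k\<close> cells.\<close>

lemma integrable_mult_drho:
  assumes "u \<in> Vh J" and "J \<ge> 1" and g: "continuous_on {0..1} g"
  shows "(\<lambda>\<rho>. g \<rho> * drho u \<rho>) integrable_on {0..1::real}"
proof -
  have "(\<lambda>\<rho>. g \<rho> * drho u \<rho>) integrable_on {0..real k / real J}" if "k \<le> J" for k
    using that
  proof (induction k)
    case 0
    show ?case using integrable_on_refl[of _ "0::real"] by simp
  next
    case (Suc k)
    let ?a = "real k / real J" and ?b = "real (Suc k) / real J"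
    have kJ: "k < J" using Suc.prems by simp
    obtain d where d: "\<And>\<rho>. \<rho> \<in> {?a<..<?b} \<Longrightarrow> (u has_vector_derivative d) (at \<rho>)"
      using assms(1) kJ by (rule Vh_cell_derivative) blast
    have drho: "drho u \<rho> = d" if "\<rho> \<in> {?a<..<?b}" for \<rho>
      using subsetD[OF cell_subset[OF kJ] that]
      by (intro drho_eqI[OF has_vector_derivative_at_within[OF d[OF that]]]) auto
    have "?b \<le> 1" "0 \<le> ?a" using Suc.prems assms(2) by (auto simp: divide_le_eq_1)
    then have "continuous_on {?a..?b} (\<lambda>\<rho>. g \<rho> * d)"
      by (intro continuous_intros continuous_on_subset[OF g]) auto
    then have "(\<lambda>\<rho>. g \<rho> * d) integrable_on {?a..?b}"
      by (rule integrable_continuous_real)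
    \<comment> \<open>On the open cell the integrand is continuous; the unknown values of
      \<open>drho u\<close> at the two end points are discarded as a finite set.\<close>
    then have "(\<lambda>\<rho>. g \<rho> * drho u \<rho>) integrable_on {?a..?b}"
      by (rule integrable_spike_finite[of "{?a, ?b}", rotated 2]) (auto simp: drho)
    moreover have "?a \<le> ?b" by (simp add: divide_right_mono)
    ultimately show ?case
      using Suc kJ by (intro Henstock_Kurzweil_Integration.integrable_combine[of 0 ?a ?b]) auto
  qed
  from this[of J] assms(2) show ?thesis by simp
qed

section \<open>The volume flux and the test with a constant\<close>

lemma perp_simps [simp]: "perp v $ 1 = v $ 2" "perp v $ 2 = - v $ 1"
  by (simp_all add: perp_def)

lemma inner_fhalf:
  "6 * ((X' \<rho> - X \<rho>) \<bullet> fhalf X X' \<rho>) =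
     (X' \<rho> $ 2 - X \<rho> $ 2) * (2 * X \<rho> $ 1 * drho X \<rho> $ 1 + 2 * X' \<rho> $ 1 * drho X' \<rho> $ 1
        + X \<rho> $ 1 * drho X' \<rho> $ 1 + X' \<rho> $ 1 * drho X \<rho> $ 1)
     - (X' \<rho> $ 1 - X \<rho> $ 1) * (2 * X \<rho> $ 1 * drho X \<rho> $ 2 + 2 * X' \<rho> $ 1 * drho X' \<rho> $ 2
        + X \<rho> $ 1 * drho X' \<rho> $ 2 + X' \<rho> $ 1 * drho X \<rho> $ 2)"
proof -
  have "fhalf X X' \<rho> $ 1 = - 1 / 6 * (2 * X \<rho> $ 1 * drho X \<rho> $ 2 + 2 * X' \<rho> $ 1 * drho X' \<rho> $ 2
        + X \<rho> $ 1 * drho X' \<rho> $ 2 + X' \<rho> $ 1 * drho X \<rho> $ 2)"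
    "fhalf X X' \<rho> $ 2 = 1 / 6 * (2 * X \<rho> $ 1 * drho X \<rho> $ 1 + 2 * X' \<rho> $ 1 * drho X' \<rho> $ 1
        + X \<rho> $ 1 * drho X' \<rho> $ 1 + X' \<rho> $ 1 * drho X \<rho> $ 1)"
    by (simp_all add: fhalf_def field_simps)
  \<comment> \<open>The brackets stay atomic as \<open>v\<close> and \<open>w\<close>, so that only
    the coefficients 1/6 are cleared.\<close>
  moreover have "6 * (a * (- 1 / 6 * v) + b * (1 / 6 * w)) = b * w - a * v" for a b v w :: real
    by (simp add: algebra_simps)
  ultimately show ?thesis
    by (simp only: inner_vec_def sum_2 inner_real_def vector_minus_component)
qed

text \<open>\<open>fhalf X X'\<close> is the exact average of \<open>- perp (r X_rho)\<close> along
  the linear interpolation from \<open>X\<close> to \<open>X'\<close>: the weights 1/3 and 1/6 are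
  the integrals of s^2 and s(1-s) over [0,1]. Hence the flux gives the volume change without a time
  discretisation error.\<close>

lemma flux_has_integral:
  assumes X: "discrete_curve hole J X" and X': "discrete_curve hole J X'" and J: "J \<ge> 1"
  shows "((\<lambda>\<rho>. (X' \<rho> - X \<rho>) \<bullet> fhalf X X' \<rho>) has_integral (vol X' - vol X) / (2 * pi)) {0..1}"
proof -
  define r z r' z' where rz: "r = (\<lambda>s. X s $ 1)" "z = (\<lambda>s. X s $ 2)" "r' = (\<lambda>s. X' s $ 1)" "z' = (\<lambda>s. X' s $ 2)"
  have Vh: "r \<in> Vh J" "z \<in> Vh J" "r' \<in> Vh J" "z' \<in> Vh J"
    using X X' by (auto simp: discrete_curve_def prod_space_def rz)
  note cont = Vh[THEN Vh_continuous]
  \<comment> \<open>With Q = r^2 + r r' + r'^2, six times the flux has coefficient 3 r^2 - Q at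
    z_rho and Q - 3 r'^2 at z'_rho. The product (z' - z) Q supplies the terms in Q, the two
    corrections the rest.\<close>
  define H where "H = (\<lambda>\<rho>. (z' \<rho> - z \<rho>) * (r \<rho> * r \<rho> + r' \<rho> * r' \<rho> + r \<rho> * r' \<rho>)
    - 3 * (r' \<rho> * r' \<rho> * z' \<rho>) + 3 * (r \<rho> * r \<rho> * z \<rho>))"
  define F where "F = (\<lambda>\<rho>. 6 * ((X' \<rho> - X \<rho>) \<bullet> fhalf X X' \<rho>)
    - 6 * (r' \<rho> * z' \<rho> * drho r' \<rho> - r \<rho> * z \<rho> * drho r \<rho>))"
  have ends: "H 0 = 0" "H 1 = 0"
    using X X' by (cases hole; auto simp: discrete_curve_def H_def rz)+
  have "(F has_integral (H 1 - H 0)) {0..1}"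
  \<comment> \<open>This form of the fundamental theorem tolerates finitely many exceptional points:
    \<open>H\<close> is continuous throughout but may have kinks on the mesh.\<close>
  proof (rule fundamental_theorem_of_calculus_interior_strong[OF finite_mesh[of J]])
    show "continuous_on {0..1} H"
      unfolding H_def by (intro continuous_intros cont)
    fix \<rho> :: real assume \<rho>: "\<rho> \<in> {0<..<1} - mesh J"
    note d = Vh[THEN Vh_has_vector_derivative, OF \<rho> J, folded has_real_derivative_iff_has_vector_derivative]
    have "X \<in> prod_space (Vh J) (Vh J)" "X' \<in> prod_space (Vh J) (Vh J)"
      using X X' by (auto simp: discrete_curve_def)
    note c = this[THEN drho_component(1), OF \<rho> J, folded rz] this[THEN drho_component(2), OF \<rho> J, folded rz]
    have "(H has_real_derivative F \<rho>) (at \<rho>)"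
      unfolding H_def F_def inner_fhalf c
      by (rule derivative_eq_intros d refl)+ (simp add: rz algebra_simps)
    then show "(H has_vector_derivative F \<rho>) (at \<rho>)"
      by (simp add: has_real_derivative_iff_has_vector_derivative)
  qed simp
  then have F: "(F has_integral 0) {0..1}" by (simp add: ends)
  have vol: "((\<lambda>\<rho>. u \<rho> * v \<rho> * drho u \<rho>) has_integral integral {0..1} (\<lambda>\<rho>. u \<rho> * v \<rho> * drho u \<rho>)) {0..1}"
    if "u \<in> Vh J" "v \<in> Vh J" for u v
    by (intro integrable_integral integrable_mult_drho[OF _ J] continuous_on_mult that[THEN Vh_continuous] that)
  \<comment> \<open>Recovering the flux from \<open>F\<close> and the volume densities yields its
    integrability together with its value.\<close>
  have "((\<lambda>\<rho>. F \<rho> / 6 + (r' \<rho> * z' \<rho> * drho r' \<rho> - r \<rho> * z \<rho> * drho r \<rho>)) has_integral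
      0 / 6 + (integral {0..1} (\<lambda>\<rho>. r' \<rho> * z' \<rho> * drho r' \<rho>) - integral {0..1} (\<lambda>\<rho>. r \<rho> * z \<rho> * drho r \<rho>))) {0..1}"
    by (intro has_integral_add has_integral_diff has_integral_divide F vol Vh)
  moreover have "F \<rho> / 6 + (r' \<rho> * z' \<rho> * drho r' \<rho> - r \<rho> * z \<rho> * drho r \<rho>) = (X' \<rho> - X \<rho>) \<bullet> fhalf X X' \<rho>" for \<rho>
    by (simp add: F_def diff_divide_distrib)
  moreover have "(vol X' - vol X) / (2 * pi) = 0 / 6 +
      (integral {0..1} (\<lambda>\<rho>. r' \<rho> * z' \<rho> * drho r' \<rho>) - integral {0..1} (\<lambda>\<rho>. r \<rho> * z \<rho> * drho r \<rho>))"
    by (simp add: vol_def rz diff_divide_distrib)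
  ultimately show ?thesis by (simp only:)
qed

lemma eqD1_flux_zero:
  assumes "eqD1 J dt X X' \<mu>'" and "dt \<noteq> 0"
  shows "integral {0..1} (\<lambda>\<rho>. (X' \<rho> - X \<rho>) \<bullet> fhalf X X' \<rho>) = 0"
proof -
  \<comment> \<open>\<open>drho\<close> of a constant vanishes at every point of the closed
    interval, end points included, so the integrand is 0 whatever the denominator is.\<close>
  have "ip (\<lambda>\<rho>. X \<rho> $ 1 * drho \<mu>' \<rho>) (\<lambda>\<rho>. drho (\<lambda>_. 1 :: real) \<rho> / norm (drho X \<rho>))
      = integral {0..1 :: real} (\<lambda>_. 0)"
    unfolding ip_def by (rule Henstock_Kurzweil_Integration.integral_cong) simp
  moreover have "ip (\<lambda>\<rho>. (X' \<rho> - X \<rho>) /\<^sub>R dt) (\<lambda>\<rho>. 1 *\<^sub>R fhalf X X' \<rho>)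
      + ip (\<lambda>\<rho>. X \<rho> $ 1 * drho \<mu>' \<rho>) (\<lambda>\<rho>. drho (\<lambda>_. 1 :: real) \<rho> / norm (drho X \<rho>)) = 0"
    using bspec[OF assms(1)[unfolded eqD1_def] Vh_const[of 1]] .
  ultimately show ?thesis
    using assms(2) by (simp add: ip_def)
qed

theorem theorem5p3:
  fixes J M q :: nat
    and T \<epsilon> \<eta> \<sigma> :: real
    and t :: "nat \<Rightarrow> real"
    and \<gamma> S :: "real \<Rightarrow> real"
    and hole :: bool
    and X :: "nat \<Rightarrow> real \<Rightarrow> real ^ 2"
    and \<theta> \<mu> \<mu>S \<kappa> :: "nat \<Rightarrow> real \<Rightarrow> real"
  assumes "J \<ge> 1" and "M \<ge> 1"
    and "t 0 = 0" and "t M = T" and "\<And>m. m < M \<Longrightarrow> t m < t (Suc m)"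
    and "\<epsilon> > 0" and "\<eta> > 0" and "q \<in> {0, 1}"
    and "C2 \<gamma>" and "\<And>x. \<gamma> x > 0" and "\<And>x. \<gamma> (- x) = \<gamma> x" and "\<And>x. \<gamma> (x + 2 * pi) = \<gamma> x"
    and initial_data: "discrete_curve hole J (X 0)" "tangent_angle J (X 0) (\<theta> 0)"
      "\<mu> 0 \<in> Vh J" "\<mu>S 0 \<in> Vh0 J" "\<kappa> 0 \<in> Vh J"
    and solution: "\<And>m. m < M \<Longrightarrow>
      scheme_step hole J q \<epsilon> \<eta> \<sigma> \<gamma> S (t (Suc m) - t m)
        (X m) (\<theta> m) (\<mu>S m) (\<kappa> m)
        (X (Suc m)) (\<theta> (Suc m)) (\<mu> (Suc m)) (\<mu>S (Suc m)) (\<kappa> (Suc m))"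
  shows "\<forall>m<M. vol (X (Suc m)) - vol (X m) = 0"
proof (intro allI impI)
  fix m assume m: "m < M"
  have curve: "discrete_curve hole J (X k)" if "k \<le> M" for k
    \<comment> \<open>Each step constrains only the new curve, so level 0 comes from the initial
      data.\<close>
    using that initial_data(1) solution by (cases k) (auto simp: scheme_step_def)
  have "eqD1 J (t (Suc m) - t m) (X m) (X (Suc m)) (\<mu> (Suc m))"
    using solution[OF m] by (simp add: scheme_step_def)
  moreover have "t (Suc m) - t m \<noteq> 0"
    using \<open>\<And>m. m < M \<Longrightarrow> t m < t (Suc m)\<close>[OF m] by simp
  ultimately have "integral {0..1} (\<lambda>\<rho>. (X (Suc m) \<rho> - X m \<rho>) \<bullet> fhalf (X m) (X (Suc m)) \<rho>) = 0"
    by (rule eqD1_flux_zero)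
  \<comment> \<open>A vanishing \<open>integral\<close> alone would be inconclusive, since it
    defaults to 0 for nonintegrable functions; \<open>has_integral\<close> rules this out.\<close>
  moreover have "((\<lambda>\<rho>. (X (Suc m) \<rho> - X m \<rho>) \<bullet> fhalf (X m) (X (Suc m)) \<rho>) has_integral
      (vol (X (Suc m)) - vol (X m)) / (2 * pi)) {0..1}"
    using m \<open>J \<ge> 1\<close> by (intro flux_has_integral[OF curve curve]) auto
  ultimately show "vol (X (Suc m)) - vol (X m) = 0"
    by (simp add: has_integral_integrable_integral)
qed

end
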